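(* Let $a>0$ and let $(g_n)_{n\in\mathbb N}$ be an $a$-linearly independent sequence in $L^2(\mathbb R)$. Then there exists an $a$-orthonormal sequence $(e_n)_{n\in\mathbb N}$ such that for all $n\in\mathbb N$, $$\operatorname{span}(E_{m/a}g_k)_{m\in\mathbb Z,\,1\le k\le n}=\operatorname{span}(E_{m/a}e_k)_{m\in\mathbb Z,\,1\le k\le n}.$$
   Context: For $f,g\in L^2(\mathbb R)$ (complex-valued), the $a$-inner product is the $a$-periodic function $\langle f,g\rangle_a(t)=\sum_{n\in\mathbb Z}f(t-na)\overline{g(t-na)}$ (converging unconditionally a.e.), and $\|f\|_a(t)=\sqrt{\langle f,f\rangle_a(t)}$. A sequence $(e_n)$ in $L^2(\mathbb R)$ is $a$-orthonormal if $\langle e_n,e_m\rangle_a=0$ a.e. for all $n\neq m$, and for every $n$, $\|e_n\|_a(t)=1$ for a.e. $t$ with $\|e_n\|_a(t)\ne 0$. $E_c f(x)=e^{2\pi i c x}f(x)$. "span" denotes the closed linear span in $L^2(\mathbb R)$. A finite family $(g_n)_{n=1}^k$ in $L^2(\mathbb R)$ is $a$-linearly independent if for each $1\le n\le k$, $g_n\notin\operatorname{span}(E_{m/a}g_i)_{m\in\mathbb Z;\,1\le i\le k,\, i\ne n}$ (the span of the empty family being $\{0\}$); an arbitrary family is $a$-linearly independent if every finite subfamily is. *)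

theory Defs
  imports "HOL-Analysis.Analysis" "HOL-Library.Function_Algebras"
begin

text \<open>
  \<open>L\<^sup>2(\<real>)\<close> is represented by Borel measurable, square-integrable functions rather than by
  classes modulo almost-everywhere equality. The closed spans below are closed under
  almost-everywhere equality within this set, so equality and membership for them are
  equality and membership in the quotient.
\<close>

definition L2 :: "(real \<Rightarrow> complex) set" where
  "L2 = {f. f \<in> borel_measurable lborel \<and> integrable lborel (\<lambda>x. (cmod (f x))\<^sup>2)}"

definition L2_norm :: "(real \<Rightarrow> complex) \<Rightarrow> real" where
  "L2_norm f = sqrt (LINT x|lborel. (cmod (f x))\<^sup>2)"

definition cscale :: "complex \<Rightarrow> (real \<Rightarrow> complex) \<Rightarrow> real \<Rightarrow> complex" where
  "cscale c f = (\<lambda>x. c * f x)"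

global_interpretation cfun: vector_space cscale
  by unfold_locales (auto simp: cscale_def fun_eq_iff algebra_simps)

text \<open>Intended for \<open>S \<subseteq> L2\<close>; outside \<open>L2\<close> the value of \<^const>\<open>L2_norm\<close> is not meaningful.\<close>

definition closed_span :: "(real \<Rightarrow> complex) set \<Rightarrow> (real \<Rightarrow> complex) set" where
  "closed_span S = {f \<in> L2. \<forall>\<epsilon>>0. \<exists>h \<in> cfun.span S. L2_norm (f - h) < \<epsilon>}"

definition modulation :: "real \<Rightarrow> (real \<Rightarrow> complex) \<Rightarrow> real \<Rightarrow> complex" where
  "modulation c f = (\<lambda>x. exp (2 * of_real pi * \<i> * of_real c * of_real x) * f x)"

text \<open>
  For \<open>f\<close> and \<open>g\<close> in \<open>L2\<close> and \<open>a > 0\<close> the series converges unconditionally for almost every \<open>t\<close>;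
  on the exceptional null set \<^const>\<open>infsum\<close> takes the value 0.
\<close>

definition a_inner :: "real \<Rightarrow> (real \<Rightarrow> complex) \<Rightarrow> (real \<Rightarrow> complex) \<Rightarrow> real \<Rightarrow> complex" where
  "a_inner a f g t =
     (\<Sum>\<^sub>\<infinity>n::int. f (t - of_int n * a) * cnj (g (t - of_int n * a)))"

definition a_norm :: "real \<Rightarrow> (real \<Rightarrow> complex) \<Rightarrow> real \<Rightarrow> real" where
  "a_norm a f t = sqrt (Re (a_inner a f f t))"

definition a_orthonormal :: "real \<Rightarrow> (nat \<Rightarrow> real \<Rightarrow> complex) \<Rightarrow> bool" where
  "a_orthonormal a e \<longleftrightarrow>
     (\<forall>n. e n \<in> L2) \<and>
     (\<forall>n m. n \<noteq> m \<longrightarrow> (AE t in lborel. a_inner a (e n) (e m) t = 0)) \<and>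
     (\<forall>n. AE t in lborel. a_norm a (e n) t \<noteq> 0 \<longrightarrow> a_norm a (e n) t = 1)"

definition a_span :: "real \<Rightarrow> ('i \<Rightarrow> real \<Rightarrow> complex) \<Rightarrow> 'i set \<Rightarrow> (real \<Rightarrow> complex) set" where
  "a_span a g I = closed_span {modulation (of_int m / a) (g i) | m i. i \<in> I}"

definition a_independent_finite ::
    "real \<Rightarrow> ('i \<Rightarrow> real \<Rightarrow> complex) \<Rightarrow> 'i set \<Rightarrow> bool" where
  "a_independent_finite a g J \<longleftrightarrow> (\<forall>n\<in>J. g n \<notin> a_span a g (J - {n}))"

definition a_independent ::
    "real \<Rightarrow> ('i \<Rightarrow> real \<Rightarrow> complex) \<Rightarrow> 'i set \<Rightarrow> bool" where
  "a_independent a g I \<longleftrightarrow> (\<forall>J. finite J \<longrightarrow> J \<subseteq> I \<longrightarrow> a_independent_finite a g J)"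

end

theory Submission
  imports Defs
begin

text \<open>
  Gram--Schmidt on the fibres \<open>n \<mapsto> f (t - n a)\<close>, which lie in \<open>\<ell>\<^sup>2(\<int>)\<close> for almost every \<open>t\<close>: put
  \<open>r\<^sub>n = g\<^sub>n - (\<Sum>k<n. \<langle>g\<^sub>n, e\<^sub>k\<rangle>\<^sub>a e\<^sub>k)\<close> and \<open>e\<^sub>n = r\<^sub>n / \<parallel>r\<^sub>n\<parallel>\<^sub>a\<close>, with value \<open>0\<close> where the norm
      vanishes.
  All coefficients are \<open>a\<close>-periodic, so equality of the spans reduces to the fact that a closed
  span invariant under the modulations \<open>E\<^bsub>m/a\<^esub>\<close> contains \<open>c f\<close> whenever it contains \<open>f\<close>, \<open>c\<close> is
  \<open>a\<close>-periodic and measurable, and \<open>c f \<in> L\<^sup>2\<close>. For this, write \<open>c\<close> as a function of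
  \<open>exp (2 \<pi> i t / a)\<close>; trigonometric polynomials are multipliers by modulation invariance,
  continuous functions by Stone--Weierstrass, indicators of Borel sets by a Dynkin argument,
  and general \<open>c\<close> by dominated convergence. Bessel's inequality on the fibres shows
  that the projections \<open>\<langle>g\<^sub>n, e\<^sub>k\<rangle>\<^sub>a e\<^sub>k\<close> are in \<open>L\<^sup>2\<close>.
\<close>

section \<open>Fibres of square-integrable functions\<close>

text \<open>Bochner integrability over the counting measure on \<int>, rather than summability,
  makes linearity, domination and measurability in \<open>t\<close> available from integration
  theory.\<close>

definition fiber_l2 :: "real \<Rightarrow> (real \<Rightarrow> complex) \<Rightarrow> real \<Rightarrow> bool" where
  "fiber_l2 a f t \<longleftrightarrow>
     integrable (count_space UNIV) (\<lambda>n::int. (cmod (f (t - of_int n * a)))\<^sup>2)"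

definition periodic :: "real \<Rightarrow> (real \<Rightarrow> 'b) \<Rightarrow> bool" where
  "periodic a c \<longleftrightarrow> (\<forall>t. \<forall>n::int. c (t - of_int n * a) = c t)"

lemma periodicD: "periodic a c \<Longrightarrow> c (t - of_int n * a) = c t"
  by (simp add: periodic_def)

text \<open>For complex series unconditional and absolute convergence agree, and where they fail
  \<open>infsum\<close> and the integral both default to 0.\<close>

lemma a_inner_eq_integral:
  "a_inner a f g t =
     (LINT n|count_space UNIV. f (t - of_int (n::int) * a) * cnj (g (t - of_int n * a)))"
proof -
  define u where "u n = f (t - of_int n * a) * cnj (g (t - of_int n * a))" for n :: int
  have "infsum u UNIV = (LINT n|count_space UNIV. u n)"
  proof (cases "integrable (count_space UNIV) u")
    case True
    then have "Infinite_Set_Sum.abs_summable_on u UNIV"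
      by (simp add: abs_summable_on_def)
    from infsetsum_infsum[OF this] show ?thesis
      by (simp add: infsetsum_def)
  next
    case False
    then have "\<not> u summable_on UNIV"
      by (simp add: summable_on_iff_abs_summable_on_complex abs_summable_equivalent
          abs_summable_on_def)
    with False show ?thesis
      by (simp add: infsum_not_exists not_integrable_integral_eq)
  qed
  then show ?thesis
    by (simp add: a_inner_def u_def[abs_def])
qed

text \<open>Shifting \<open>t\<close> by \<open>m * a\<close> reindexes the series by
  \<open>n + m\<close>; a bijective reindexing is harmless even where the series diverges.\<close>

lemma periodic_a_inner: "periodic a (a_inner a f g)"
  unfolding periodic_def
proof (intro allI)
  fix t and m :: int
  have "bij_betw (\<lambda>n. n + m) (UNIV :: int set) UNIV"
    by (rule bij_betwI[where g = "\<lambda>n. n - m"]) auto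
  from infsum_reindex_bij_betw[OF this,
      of "\<lambda>n. f (t - of_int n * a) * cnj (g (t - of_int n * a))"]
  show "a_inner a f g (t - of_int m * a) = a_inner a f g t"
    by (simp add: a_inner_def algebra_simps)
qed

lemma periodic_a_norm: "periodic a (a_norm a f)"
  using periodic_a_inner[of a f f] by (simp add: periodic_def a_norm_def)

lemma a_inner_cnj: "a_inner a g f t = cnj (a_inner a f g t)"
  by (simp add: a_inner_def mult.commute flip: infsum_cnj)

lemma a_inner_scale_left:
  assumes "periodic a c"
  shows "a_inner a (\<lambda>x. c x * f x) g t = c t * a_inner a f g t"
  using assms by (simp add: a_inner_def periodicD mult.assoc infsum_cmult_right')

lemma a_inner_scale_right:
  assumes "periodic a c"
  shows "a_inner a f (\<lambda>x. c x * g x) t = cnj (c t) * a_inner a f g t"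
  using a_inner_scale_left[OF assms] by (metis a_inner_cnj complex_cnj_mult)

section \<open>Square-summable fibres: linear operations and inner products\<close>

lemma norm_add_squared_le: "(norm (x + y :: 'a :: real_normed_vector))\<^sup>2 \<le> 2 * (norm x)\<^sup>2 + 2 *
    (norm y)\<^sup>2"
proof -
  have "(norm (x + y))\<^sup>2 \<le> (norm x + norm y)\<^sup>2"
    by (intro power_mono norm_triangle_ineq) auto
  also have "\<dots> \<le> 2 * (norm x)\<^sup>2 + 2 * (norm y)\<^sup>2"
    using sum_squares_bound[of "norm x" "norm y"] by (simp add: power2_sum)
  finally show ?thesis .
qed

lemma fiber_l2_add:
  assumes "fiber_l2 a f t" "fiber_l2 a g t"
  shows "fiber_l2 a (\<lambda>x. f x + g x) t"
  unfolding fiber_l2_def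
  by (rule Bochner_Integration.integrable_bound[where f = "\<lambda>n. 2 * (cmod (f
      (t - of_int n * a)))\<^sup>2 + 2 * (cmod (g (t - of_int n * a)))\<^sup>2"])
    (use assms in \<open>auto simp: fiber_l2_def norm_add_squared_le\<close>)

lemma fiber_l2_scale:
  assumes "fiber_l2 a f t" "periodic a c"
  shows "fiber_l2 a (\<lambda>x. c x * f x) t"
  using assms by (simp add: fiber_l2_def periodicD norm_mult power_mult_distrib)

lemma fiber_l2_0: "fiber_l2 a (\<lambda>x. 0) t"
  by (simp add: fiber_l2_def)

lemma fiber_l2_uminus: "fiber_l2 a f t \<Longrightarrow> fiber_l2 a (\<lambda>x. - f x) t"
  by (simp add: fiber_l2_def)

lemma fiber_l2_diff:
  "fiber_l2 a f t \<Longrightarrow> fiber_l2 a g t \<Longrightarrow> fiber_l2 a (\<lambda>x. f x - g x) t"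
  using fiber_l2_add[of a f t "\<lambda>x. - g x"] fiber_l2_uminus[of a g t] by simp

lemma fiber_l2_sum:
  "(\<And>k. k \<in> K \<Longrightarrow> fiber_l2 a (f k) t) \<Longrightarrow> fiber_l2 a (\<lambda>x. \<Sum>k\<in>K. f k x) t"
  by (induction K rule: infinite_finite_induct) (auto simp: fiber_l2_0 fiber_l2_add)

text \<open>The bound x y \<le> x^2 + y^2 dominates the product by the sum of two summable
  sequences.\<close>

lemma integrable_fiber_prod:
  assumes "fiber_l2 a f t" "fiber_l2 a g t"
  shows "integrable (count_space UNIV)
           (\<lambda>n::int. f (t - of_int n * a) * cnj (g (t - of_int n * a)))"
proof (rule Bochner_Integration.integrable_bound)
  show "integrable (count_space UNIV)
          (\<lambda>n::int. (cmod (f (t - of_int n * a)))\<^sup>2 + (cmod (g (t - of_int n * a)))\<^sup>2)"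
    using assms by (simp add: fiber_l2_def)
  have "x * y \<le> x\<^sup>2 + y\<^sup>2" if "x \<ge> 0" "y \<ge> 0" for x y :: real
    using sum_squares_bound[of x y] that mult_nonneg_nonneg[OF that] by linarith
  then show "AE n in count_space UNIV. norm (f (t - of_int (n::int) * a) * cnj (g
      (t - of_int n * a)))
      \<le> norm ((cmod (f (t - of_int n * a)))\<^sup>2 + (cmod (g (t - of_int n * a)))\<^sup>2)"
    by (auto simp: norm_mult)
qed simp

lemma a_inner_diff_left:
  assumes "fiber_l2 a f t" "fiber_l2 a g t" "fiber_l2 a h t"
  shows "a_inner a (\<lambda>x. f x - g x) h t = a_inner a f h t - a_inner a g h t"
  using assms by (simp add: a_inner_eq_integral left_diff_distrib integrable_fiber_prod)

lemma a_inner_sum_left: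
  assumes "\<And>k. k \<in> K \<Longrightarrow> fiber_l2 a (f k) t" "fiber_l2 a h t"
  shows "a_inner a (\<lambda>x. \<Sum>k\<in>K. f k x) h t = (\<Sum>k\<in>K. a_inner a (f k) h t)"
  using assms by (simp add: a_inner_eq_integral sum_distrib_right integrable_fiber_prod)

section \<open>The fibre norm and Bessel's inequality\<close>

lemma a_inner_self:
  "a_inner a f f t = of_real (LINT n|count_space UNIV. (cmod (f (t - of_int (n::int) * a)))\<^sup>2)"
  by (simp add: a_inner_eq_integral complex_norm_square[symmetric] flip: integral_complex_of_real)

lemma a_inner_self_nonneg: "0 \<le> Re (a_inner a f f t)"
  by (simp add: a_inner_self)

lemma a_norm_squared: "a_inner a f f t = of_real ((a_norm a f t)\<^sup>2)"
  by (simp add: a_norm_def a_inner_self)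

lemma a_norm_nonneg: "0 \<le> a_norm a f t"
  by (simp add: a_norm_def a_inner_self)

text \<open>The counting measure has no nonempty null set, so a vanishing fibre norm kills every
  point of the fibre.\<close>

lemma a_norm_eq_0D:
  assumes "fiber_l2 a f t" "a_norm a f t = 0"
  shows "f (t - of_int n * a) = 0"
proof -
  have "(LINT n|count_space UNIV. (cmod (f (t - of_int (n::int) * a)))\<^sup>2) = 0"
    using assms(2) by (simp add: a_norm_def a_inner_self)
  then have "AE n in count_space UNIV. (cmod (f (t - of_int (n::int) * a)))\<^sup>2 = 0"
    using assms(1) unfolding fiber_l2_def by (subst (asm) integral_nonneg_eq_0_iff_AE) auto
  then show ?thesis
    by (simp add: AE_count_space)
qed

lemma a_norm_scale:
  assumes "periodic a c"
  shows "a_norm a (\<lambda>x. c x * f x) t = cmod (c t) * a_norm a f t"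
proof -
  have "a_inner a (\<lambda>x. c x * f x) (\<lambda>x. c x * f x) t = of_real ((cmod (c t))\<^sup>2) * a_inner a f f t"
    by (simp add: a_inner_scale_left[OF assms] a_inner_scale_right[OF assms]
        complex_norm_square[symmetric, unfolded of_real_power])
  then have "a_norm a (\<lambda>x. c x * f x) t = sqrt ((cmod (c t))\<^sup>2 * Re (a_inner a f f t))"
    unfolding a_norm_def by (simp only: Re_complex_of_real a_inner_self flip: of_real_mult)
  then show ?thesis
    by (simp add: a_norm_def real_sqrt_mult)
qed

lemma a_inner_eq_0_of_a_norm_eq_0:
  assumes "fiber_l2 a e t" "a_norm a e t = 0"
  shows "a_inner a f e t = 0"
  using a_norm_eq_0D[OF assms] by (simp add: a_inner_def)

text \<open>On the fibre, \<open>h = f - c * e\<close> with \<open>c\<close> the coefficient of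
  \<open>f\<close> is orthogonal to \<open>e\<close>, whence 0 \<le> |h|^2 = |f|^2 - |c|^2. If
  \<open>e\<close> vanishes on the fibre, so does the coefficient.\<close>

lemma bessel_single:
  assumes f: "fiber_l2 a f t" and e: "fiber_l2 a e t" and ne: "a_norm a e t \<in> {0, 1}"
  shows "cmod (a_inner a f e t) \<le> a_norm a f t"
proof (cases "a_norm a e t = 0")
  case True
  then show ?thesis
    using a_inner_eq_0_of_a_norm_eq_0[OF e] by (simp add: a_norm_nonneg)
next
  case False
  then have ee: "a_inner a e e t = 1"
    using ne by (simp add: a_norm_squared)
  define c where "c = a_inner a f e t"
  \<comment> \<open>The coefficient is frozen at its value at \<open>t\<close>; as a constant it is
    periodic, so the scaling rules apply.\<close>
  have per: "periodic a (\<lambda>x. c)"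
    by (simp add: periodic_def)
  define h where "h x = f x - c * e x" for x
  have ce: "fiber_l2 a (\<lambda>x. c * e x) t"
    by (rule fiber_l2_scale[OF e per])
  have h: "fiber_l2 a h t"
    unfolding h_def by (intro fiber_l2_diff f ce)
  have he: "a_inner a h e t = 0"
    unfolding h_def
    by (subst a_inner_diff_left[OF f ce e]) (simp add: a_inner_scale_left[OF per] ee flip: c_def)
  have "a_inner a h h t = a_inner a f h t - c * a_inner a e h t"
    using a_inner_diff_left[OF f ce h] by (simp add: a_inner_scale_left[OF per] flip: h_def)
  also have "a_inner a e h t = 0"
    using he a_inner_cnj[of a e h t] by simp
  also have "a_inner a f h t = cnj (a_inner a h f t)"
    by (rule a_inner_cnj)
  also have "a_inner a h f t = a_inner a f f t - c * cnj c"
    unfolding h_def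
    by (subst a_inner_diff_left[OF f ce f])
      (simp add: a_inner_scale_left[OF per] a_inner_cnj[of a e f] flip: c_def)
  finally have "Re (a_inner a h h t) = Re (a_inner a f f t) - (cmod c)\<^sup>2"
    by (simp add: complex_mult_cnj cmod_power2)
  then have "(cmod c)\<^sup>2 \<le> (a_norm a f t)\<^sup>2"
    using a_inner_self_nonneg[of a h t] by (simp add: a_norm_def a_inner_self_nonneg)
  then show ?thesis
    using a_norm_nonneg power2_le_imp_le c_def by blast
qed

section \<open>Measurability in \<open>t\<close> and integration over one period\<close>

lemma borel_measurable_cnj [measurable]: "cnj \<in> borel_measurable borel"
  by (intro borel_measurable_continuous_onI continuous_intros)

text \<open>An integral over the sigma-finite counting measure is measurable in its parameter
  \<open>t\<close>, everywhere and not only off a null set.\<close>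

lemma borel_measurable_a_inner [measurable]:
  assumes [measurable]: "f \<in> borel_measurable borel" "g \<in> borel_measurable borel"
  shows "a_inner a f g \<in> borel_measurable borel"
proof -
  interpret sigma_finite_measure "count_space (UNIV :: int set)"
    by (rule sigma_finite_measure_count_space)
  have "(\<lambda>t. LINT n|count_space UNIV. f (t - of_int (n::int) * a) * cnj (g (t - of_int n * a)))
          \<in> borel_measurable borel"
  proof (rule borel_measurable_lebesgue_integral)
    show "(\<lambda>(t, n). f (t - of_int (n::int) * a) * cnj (g (t - of_int n * a)))
            \<in> borel_measurable (borel \<Otimes>\<^sub>M count_space UNIV)"
      by measurable
  qed
  moreover have "a_inner a f g = (\<lambda>t. LINT n|count_space UNIV. f (t - of_int (n::int) * a) * cnj (g
      (t - of_int n * a)))"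
    by (simp add: fun_eq_iff a_inner_eq_integral)
  ultimately show ?thesis by simp
qed

lemma borel_measurable_a_norm [measurable]:
  assumes [measurable]: "f \<in> borel_measurable borel"
  shows "a_norm a f \<in> borel_measurable borel"
  unfolding a_norm_def by measurable

text \<open>The line is tiled by the translates of [0, a): insert the tiling as a sum of indicators,
  exchange sum and integral by Tonelli, and translate each piece back.\<close>

lemma nn_integral_periodization:
  fixes F :: "real \<Rightarrow> ennreal"
  assumes a: "a > 0" and [measurable]: "F \<in> borel_measurable borel"
  shows "(\<integral>\<^sup>+x. F x \<partial>lborel) =
    (\<integral>\<^sup>+t. (\<integral>\<^sup>+n. F (t - of_int (n::int) * a) \<partial>count_space UNIV) * indicator {0..<a} t \<partial>lborel)"
proof -
  have one: "(\<integral>\<^sup>+n. F x * indicator {0..<a} (x + of_int (n::int) * a) \<partial>count_space UNIV) = F x"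
      for x
  proof -
    \<comment> \<open>Exactly one translate of \<open>x\<close> by a multiple of \<open>a\<close>
      lies in [0, a).\<close>
    have "x + of_int n * a \<in> {0..<a} \<longleftrightarrow> n = - \<lfloor>x / a\<rfloor>" for n :: int
    proof -
      have "x + of_int n * a \<in> {0..<a} \<longleftrightarrow> of_int (- n) \<le> x / a \<and> x / a < of_int (- n) + 1"
        using a by (auto simp: field_simps)
      also have "\<dots> \<longleftrightarrow> \<lfloor>x / a\<rfloor> = - n"
        by (auto simp: floor_eq_iff)
      finally show ?thesis by auto
    qed
    then have "(\<lambda>n. F x * indicator {0..<a} (x + of_int n * a)) =
        (\<lambda>n. F x * indicator {- \<lfloor>x / a\<rfloor>} n)"
      by (auto simp: indicator_def fun_eq_iff)
    then show ?thesis
      by (simp add: nn_integral_cmult)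
  qed
  have "(\<integral>\<^sup>+x. F x \<partial>lborel) =
      (\<integral>\<^sup>+x. (\<integral>\<^sup>+n. F x * indicator {0..<a} (x + of_int (n::int) * a) \<partial>count_space UNIV) \<partial>lborel)"
    by (simp add: one)
  also have "\<dots> = (\<integral>\<^sup>+n. (\<integral>\<^sup>+x. F x * indicator {0..<a} (x + of_int
      (n::int) * a) \<partial>lborel) \<partial>count_space UNIV)"
    by (rule nn_integral_count_space_nn_integral) auto
  also have "\<dots> = (\<integral>\<^sup>+n. (\<integral>\<^sup>+t. F (t - of_int (n::int) * a) * indicator {0..<a} t \<partial>lborel)
      \<partial>count_space UNIV)"
  proof (rule nn_integral_cong)
    fix n :: int
    show "(\<integral>\<^sup>+x. F x * indicator {0..<a} (x + of_int n * a) \<partial>lborel) =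
        (\<integral>\<^sup>+t. F (t - of_int n * a) * indicator {0..<a} t \<partial>lborel)"
      by (subst nn_integral_real_affine[where c = 1 and t = "- of_int n * a"])
          (auto simp: add.commute)
  qed
  also have "\<dots> = (\<integral>\<^sup>+t. (\<integral>\<^sup>+n. F (t - of_int (n::int) * a) * indicator {0..<a} t \<partial>count_space UNIV)
      \<partial>lborel)"
    by (rule nn_integral_count_space_nn_integral[symmetric]) auto
  also have "\<dots> = (\<integral>\<^sup>+t. (\<integral>\<^sup>+n. F (t - of_int (n::int) * a) \<partial>count_space UNIV) * indicator {0..<a} t
      \<partial>lborel)"
    by (simp add: nn_integral_multc)
  finally show ?thesis .
qed

lemma L2_iff_nn_integral:
  "f \<in> L2 \<longleftrightarrow> f \<in> borel_measurable borel \<and> (\<integral>\<^sup>+x. ennreal ((cmod (f x))\<^sup>2) \<partial>lborel) < \<infinity>"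
  by (auto simp: L2_def integrable_iff_bounded)

lemma L2_measurable: "f \<in> L2 \<Longrightarrow> f \<in> borel_measurable borel"
  by (simp add: L2_def)

lemma nn_integral_fiber_l2:
  assumes "fiber_l2 a f t"
  shows "(\<integral>\<^sup>+n. ennreal ((cmod (f (t - of_int (n::int) * a)))\<^sup>2) \<partial>count_space UNIV) = ennreal
      ((a_norm a f t)\<^sup>2)"
  using assms unfolding fiber_l2_def
  by (subst nn_integral_eq_integral) (auto simp: a_norm_def a_inner_self)

lemma borel_measurable_nn_fiber [measurable]:
  fixes F :: "real \<Rightarrow> ennreal"
  assumes [measurable]: "F \<in> borel_measurable borel"
  shows "(\<lambda>t. \<integral>\<^sup>+n. F (t - of_int (n::int) * a) \<partial>count_space UNIV) \<in> borel_measurable borel"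
proof -
  interpret sigma_finite_measure "count_space (UNIV :: int set)"
    by (rule sigma_finite_measure_count_space)
  show ?thesis by measurable
qed

text \<open>The fibre sum \<open>P\<close> has finite integral over [0, a), hence is finite almost
  everywhere there; periodicity carries this to the whole line.\<close>

lemma L2_AE_fiber_l2:
  assumes a: "a > 0" and f: "f \<in> L2"
  shows "AE t in lborel. fiber_l2 a f t"
proof -
  note [measurable] = L2_measurable[OF f]
  define P where "P t = (\<integral>\<^sup>+n. ennreal ((cmod (f (t - of_int (n::int) * a)))\<^sup>2) \<partial>count_space UNIV)"
      for t
  have [measurable]: "P \<in> borel_measurable borel"
    unfolding P_def by measurable
  have P_per: "P (t - of_int m * a) = P t" for t and m :: int
  proof -
    have "bij_betw (\<lambda>n. n + m) (UNIV :: int set) UNIV"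
      by (rule bij_betwI[where g = "\<lambda>n. n - m"]) auto
    from nn_integral_bij_count_space[OF this, of "\<lambda>n. ennreal ((cmod (f (t - of_int n * a)))\<^sup>2)"]
    show ?thesis by (simp add: P_def algebra_simps)
  qed
  have "(\<integral>\<^sup>+t. P t * indicator {0..<a} t \<partial>lborel) \<noteq> \<infinity>"
    using f unfolding L2_iff_nn_integral
    by (subst (asm) nn_integral_periodization[OF a]) (auto simp: P_def)
  then have "AE t in lborel. P t * indicator {0..<a} t \<noteq> \<infinity>"
    by (intro nn_integral_PInf_AE) auto
  then have *: "AE t in lborel. (\<integral>\<^sup>+n. indicator {t. P t = \<infinity>} (t - of_int
      (n::int) * a) \<partial>count_space UNIV) * indicator {0..<a} t = (0 :: ennreal)"
    by eventually_elim (auto simp: indicator_def P_per)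
  \<comment> \<open>Periodization is now applied to the indicator of the bad set: all translates of
    a good \<open>t\<close> are good, so the bad set is null.\<close>
  have "(\<integral>\<^sup>+t. indicator {t. P t = \<infinity>} t \<partial>lborel) = (0 :: ennreal)"
    by (subst nn_integral_periodization[OF a]) (use * in \<open>auto simp: nn_integral_0_iff_AE\<close>)
  then have "AE t in lborel. P t \<noteq> \<infinity>"
    by (subst (asm) nn_integral_0_iff_AE) (auto simp: indicator_def)
  then show ?thesis
    by eventually_elim (auto simp: fiber_l2_def integrable_iff_bounded P_def less_top)
qed

text \<open>By periodization the squared L2 norm is the integral of the squared fibre norm over one
  period, so a majorant integrable there suffices.\<close>

lemma L2_of_a_norm_le:
  assumes a: "a > 0" and [measurable]: "f \<in> borel_measurable borel"
    and f: "AE t in lborel. fiber_l2 a f t"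
    and le: "AE t in lborel. ennreal ((a_norm a f t)\<^sup>2) \<le> B t"
    and B: "(\<integral>\<^sup>+t. B t * indicator {0..<a} t \<partial>lborel) < \<infinity>"
  shows "f \<in> L2"
proof -
  have "(\<integral>\<^sup>+x. ennreal ((cmod (f x))\<^sup>2) \<partial>lborel) \<le> (\<integral>\<^sup>+t. B t * indicator {0..<a} t \<partial>lborel)"
    by (subst nn_integral_periodization[OF a], simp, rule nn_integral_mono_AE)
      (use f le in eventually_elim, auto simp: nn_integral_fiber_l2 intro!: mult_right_mono)
  also note B
  finally show ?thesis
    by (simp add: L2_iff_nn_integral)
qed

lemma L2_a_norm_integral:
  assumes a: "a > 0" and f: "f \<in> L2"
  shows "(\<integral>\<^sup>+t. ennreal ((a_norm a f t)\<^sup>2) * indicator {0..<a} t \<partial>lborel) < \<infinity>"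
proof -
  note [measurable] = L2_measurable[OF f]
  have "(\<integral>\<^sup>+t. ennreal ((a_norm a f t)\<^sup>2) * indicator {0..<a} t \<partial>lborel) =
      (\<integral>\<^sup>+x. ennreal ((cmod (f x))\<^sup>2) \<partial>lborel)"
    by (subst (2) nn_integral_periodization[OF a], simp, rule nn_integral_cong_AE)
      (use L2_AE_fiber_l2[OF a f] in eventually_elim, auto simp: nn_integral_fiber_l2)
  then show ?thesis
    using f by (simp add: L2_iff_nn_integral)
qed

section \<open>Closed spans\<close>

lemma L2_norm_squared: "(L2_norm f)\<^sup>2 = (LINT x|lborel. (cmod (f x))\<^sup>2)"
  by (simp add: L2_norm_def)

lemma L2_norm_nonneg: "0 \<le> L2_norm f"
  by (simp add: L2_norm_def)

lemma L2_0: "0 \<in> L2"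
  by (simp add: L2_def zero_fun_def)

lemma L2_add:
  assumes "f \<in> L2" "g \<in> L2"
  shows "f + g \<in> L2"
proof -
  note [measurable] = L2_measurable[OF assms(1)] L2_measurable[OF assms(2)]
  have "integrable lborel (\<lambda>x. (cmod (f x + g x))\<^sup>2)"
    by (rule Bochner_Integration.integrable_bound[where f = "\<lambda>x. 2 * (cmod (f x))\<^sup>2 + 2 * (cmod
        (g x))\<^sup>2"])
      (use assms in \<open>auto simp: L2_def norm_add_squared_le\<close>)
  then show ?thesis
    by (simp add: L2_def plus_fun_def)
qed

lemma L2_scale: "f \<in> L2 \<Longrightarrow> cscale c f \<in> L2"
  by (auto simp: L2_def cscale_def norm_mult power_mult_distrib)

lemma L2_diff: "f \<in> L2 \<Longrightarrow> g \<in> L2 \<Longrightarrow> f - g \<in> L2"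
  using L2_add[of f "cscale (-1) g"] L2_scale[of g "-1"]
  by (simp add: cscale_def plus_fun_def fun_diff_def)

lemma subspace_L2: "cfun.subspace L2"
  by (simp add: cfun.subspace_def L2_0 L2_add L2_scale)

lemma span_L2: "S \<subseteq> L2 \<Longrightarrow> cfun.span S \<subseteq> L2"
  by (intro cfun.span_minimal subspace_L2)

text \<open>The factor 2 comes from |x + y|^2 \<le> 2|x|^2 + 2|y|^2, which stands in for Minkowski;
  approximation arguments absorb it in the choice of epsilon.\<close>

lemma L2_norm_add_le:
  assumes "f \<in> L2" "g \<in> L2"
  shows "L2_norm (f + g) \<le> 2 * (L2_norm f + L2_norm g)"
proof (rule power2_le_imp_le)
  have fg: "integrable lborel (\<lambda>x. (cmod (f x))\<^sup>2)" "integrable lborel (\<lambda>x. (cmod (g x))\<^sup>2)"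
    using assms by (auto simp: L2_def)
  have "(L2_norm (f + g))\<^sup>2 \<le> (LINT x|lborel. 2 * (cmod (f x))\<^sup>2 + 2 * (cmod (g x))\<^sup>2)"
    unfolding L2_norm_squared plus_fun_def
    by (rule integral_mono) (use L2_add[OF assms] fg in \<open>auto simp: L2_def plus_fun_def
        norm_add_squared_le\<close>)
  also have "\<dots> = 2 * (L2_norm f)\<^sup>2 + 2 * (L2_norm g)\<^sup>2"
    using fg by (simp add: L2_norm_squared)
  also have "\<dots> \<le> (2 * (L2_norm f + L2_norm g))\<^sup>2"
  proof -
    have "0 \<le> L2_norm f * L2_norm g"
      by (simp add: L2_norm_nonneg)
    then show ?thesis by (simp add: power2_eq_square algebra_simps)
  qed
  finally show "(L2_norm (f + g))\<^sup>2 \<le> (2 * (L2_norm f + L2_norm g))\<^sup>2" .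
qed (simp add: L2_norm_nonneg)

lemma L2_norm_scale: "L2_norm (cscale c f) = cmod c * L2_norm f"
  by (simp add: L2_norm_def cscale_def norm_mult power_mult_distrib real_sqrt_mult)

lemma closed_spanD:
  "f \<in> closed_span S \<Longrightarrow> e > 0 \<Longrightarrow> \<exists>h\<in>cfun.span S. L2_norm (f - h) < e"
  by (simp add: closed_span_def)

lemma closed_span_subset_L2: "closed_span S \<subseteq> L2"
  by (auto simp: closed_span_def)

lemma span_subset_closed_span:
  assumes "S \<subseteq> L2"
  shows "cfun.span S \<subseteq> closed_span S"
proof -
  have "L2_norm (f - f) = 0" for f
    by (simp add: L2_norm_def)
  then show ?thesis
    using span_L2[OF assms] unfolding closed_span_def by (smt (verit) mem_Collect_eq subset_iff)
qed

lemma closed_span_approx: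
  assumes S: "S \<subseteq> L2" and f: "f \<in> L2"
    and approx: "\<And>e. e > 0 \<Longrightarrow> \<exists>h\<in>closed_span S. L2_norm (f - h) < e"
  shows "f \<in> closed_span S"
  unfolding closed_span_def
proof (intro CollectI conjI f allI impI)
  fix e :: real assume "e > 0"
  \<comment> \<open>The fraction \<open>e / 4\<close> offsets the factor 2 of
    \<open>L2_norm_add_le\<close>: 2 (e/4 + e/4) = e.\<close>
  then obtain h where h: "h \<in> closed_span S" "L2_norm (f - h) < e / 4"
    using approx[of "e / 4"] by auto
  then obtain k where k: "k \<in> cfun.span S" "L2_norm (h - k) < e / 4"
    using closed_spanD[of h S "e / 4"] \<open>e > 0\<close> by auto
  have "h \<in> L2" "k \<in> L2"
    using h k span_L2[OF S] closed_span_subset_L2 by auto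
  then have "L2_norm ((f - h) + (h - k)) \<le> 2 * (L2_norm (f - h) + L2_norm (h - k))"
    by (intro L2_norm_add_le L2_diff f)
  then have "L2_norm (f - k) < e"
    using h k by simp
  with k show "\<exists>k\<in>cfun.span S. L2_norm (f - k) < e" by blast
qed

lemma subspace_closed_span:
  assumes S: "S \<subseteq> L2"
  shows "cfun.subspace (closed_span S)"
  unfolding cfun.subspace_def
proof (intro conjI ballI allI)
  show "0 \<in> closed_span S"
    using span_subset_closed_span[OF S] cfun.span_zero by blast
next
  fix f g assume fg: "f \<in> closed_span S" "g \<in> closed_span S"
  have L2: "f \<in> L2" "g \<in> L2"
    using fg closed_span_subset_L2 by auto
  show "f + g \<in> closed_span S"
    unfolding closed_span_def
  proof (intro CollectI conjI L2_add L2 allI impI)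
    fix e :: real assume "e > 0"
    then obtain h k where hk: "h \<in> cfun.span S" "L2_norm (f - h) < e / 4" "k \<in> cfun.span S" "L2_norm
        (g - k) < e / 4"
      using closed_spanD[OF fg(1), of "e / 4"] closed_spanD[OF fg(2), of "e / 4"] by auto
    then have "h \<in> L2" "k \<in> L2"
      using span_L2[OF S] by auto
    then have "L2_norm ((f - h) + (g - k)) \<le> 2 * (L2_norm (f - h) + L2_norm (g - k))"
      by (intro L2_norm_add_le L2_diff L2)
    then have "L2_norm (f + g - (h + k)) < e"
      using hk by (simp add: algebra_simps)
    with hk show "\<exists>h\<in>cfun.span S. L2_norm (f + g - h) < e"
      by (blast intro: cfun.span_add)
  qed
next
  fix c f assume f: "f \<in> closed_span S"
  show "cscale c f \<in> closed_span S"
    unfolding closed_span_def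
  proof (intro CollectI conjI L2_scale allI impI)
    show "f \<in> L2"
      using f closed_span_subset_L2 by auto
    fix e :: real assume "e > 0"
    \<comment> \<open>Adding 1 keeps the divisor positive when \<open>c = 0\<close>.\<close>
    then have "e / (cmod c + 1) > 0"
      by (intro divide_pos_pos add_nonneg_pos) auto
    then obtain h where h: "h \<in> cfun.span S" "L2_norm (f - h) < e / (cmod c + 1)"
      using f unfolding closed_span_def by blast
    have "L2_norm (cscale c f - cscale c h) = cmod c * L2_norm (f - h)"
      by (simp add: L2_norm_scale flip: cfun.scale_right_diff_distrib)
    also have "\<dots> \<le> (cmod c + 1) * L2_norm (f - h)"
      by (intro mult_right_mono) (auto simp: L2_norm_nonneg)
    also have "\<dots> < e"
      using h(2) by (simp add: pos_less_divide_eq add_nonneg_pos mult.commute)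
    finally show "\<exists>h\<in>cfun.span S. L2_norm (cscale c f - h) < e"
      using h cfun.span_scale by blast
  qed
qed

lemma closed_span_minimal:
  assumes S: "S \<subseteq> L2" and T: "T \<subseteq> closed_span S"
  shows "closed_span T \<subseteq> closed_span S"
proof
  fix f assume f: "f \<in> closed_span T"
  have *: "cfun.span T \<subseteq> closed_span S"
    by (intro cfun.span_minimal T subspace_closed_span S)
  show "f \<in> closed_span S"
    using f * closed_span_subset_L2 closed_spanD by (intro closed_span_approx[OF S]) blast+
qed

text \<open>Elements are functions rather than classes; an almost everywhere equal function lies at
  distance 0.\<close>

lemma closed_span_cong_AE:
  assumes f: "f \<in> closed_span S" and S: "S \<subseteq> L2"
    and [measurable]: "g \<in> borel_measurable borel" and eq: "AE x in lborel. f x = g x"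
  shows "g \<in> closed_span S"
proof (rule closed_span_approx[OF S])
  have f2: "f \<in> L2"
    using f closed_span_subset_L2 by auto
  note [measurable] = L2_measurable[OF f2]
  have "integrable lborel (\<lambda>x. (cmod (g x))\<^sup>2) \<longleftrightarrow> integrable lborel (\<lambda>x. (cmod (f x))\<^sup>2)"
    by (rule integrable_cong_AE) (use eq in auto)
  with f2 show "g \<in> L2"
    by (simp add: L2_def)
  have "L2_norm (g - f) = 0"
    unfolding L2_norm_def
    by (subst integral_cong_AE[where g = "\<lambda>x. 0"]) (use eq in \<open>auto simp: fun_diff_def\<close>)
  then show "\<exists>h\<in>closed_span S. L2_norm (g - h) < e" if "e > 0" for e
    using f that by (intro bexI[of _ f]) auto
qed

text \<open>Dominated convergence turns pointwise convergence into L2 convergence, under which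
  closed spans are closed.\<close>

lemma closed_span_limit:
  assumes S: "S \<subseteq> L2" and F: "\<And>i. F i \<in> closed_span S" and f: "f \<in> L2"
    and lim: "\<And>x. (\<lambda>i. F i x) \<longlonglongrightarrow> f x"
    and w: "integrable lborel w" and bound: "\<And>i x. (cmod (F i x - f x))\<^sup>2 \<le> w x"
  shows "f \<in> closed_span S"
proof (rule closed_span_approx[OF S f])
  fix e :: real assume "e > 0"
  have [measurable]: "F i \<in> borel_measurable borel" "f \<in> borel_measurable borel" for i
    using F[of i] f closed_span_subset_L2 L2_measurable by blast+
  have "(\<lambda>i. LINT x|lborel. (cmod (f x - F i x))\<^sup>2) \<longlonglongrightarrow> (LINT x|(lborel :: real measure). 0)"
  proof (rule integral_dominated_convergence[where w = w])
    have "(\<lambda>i. (cmod (f x - F i x))\<^sup>2) \<longlonglongrightarrow> (cmod (f x - f x))\<^sup>2" for x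
      by (intro tendsto_intros lim)
    then show "AE x in lborel. (\<lambda>i. (cmod (f x - F i x))\<^sup>2) \<longlonglongrightarrow> 0"
      by simp
  qed (use w bound in \<open>auto simp: norm_minus_commute\<close>)
  then have "(\<lambda>i. L2_norm (f - F i)) \<longlonglongrightarrow> 0"
    unfolding L2_norm_def fun_diff_def using tendsto_real_sqrt by fastforce
  then have "\<forall>\<^sub>F i in sequentially. L2_norm (f - F i) < e"
    using \<open>e > 0\<close> by (rule order_tendstoD)
  then show "\<exists>h\<in>closed_span S. L2_norm (f - h) < e"
    using F eventually_happens'[OF sequentially_bot] by fast
qed

section \<open>Modulations as linear isometries\<close>

lemma modulation_cis: "modulation c f = (\<lambda>x. cis (2 * pi * c * x) * f x)"
  by (simp add: modulation_def cis_conv_exp algebra_simps)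

lemma norm_modulation: "cmod (modulation c f x) = cmod (f x)"
  by (simp add: modulation_cis norm_mult)

lemma modulation_measurable [measurable]:
  assumes [measurable]: "f \<in> borel_measurable borel"
  shows "modulation c f \<in> borel_measurable borel"
proof -
  have [measurable]: "(\<lambda>x::real. exp (2 * complex_of_real pi * \<i> * of_real c * of_real x))
      \<in> borel_measurable borel"
    by (intro borel_measurable_continuous_onI continuous_intros)
  show ?thesis
    unfolding modulation_def by measurable
qed

lemma L2_modulation: "f \<in> L2 \<Longrightarrow> modulation c f \<in> L2"
  by (simp add: L2_def norm_modulation modulation_measurable)

lemma modulation_add: "modulation c (f + g) = modulation c f + modulation c g"
  by (simp add: modulation_def fun_eq_iff algebra_simps)

lemma modulation_diff: "modulation c (f - g) = modulation c f - modulation c g"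
  by (simp add: modulation_def fun_eq_iff algebra_simps)

lemma modulation_scale: "modulation c (cscale d f) = cscale d (modulation c f)"
  by (simp add: modulation_def cscale_def fun_eq_iff algebra_simps)

lemma modulation_modulation: "modulation c (modulation d f) = modulation (c + d) f"
  by (simp add: modulation_def fun_eq_iff algebra_simps flip: exp_add)

lemma modulation_0: "modulation 0 f = f"
  by (simp add: modulation_def)

lemma L2_norm_modulation: "L2_norm (modulation c f) = L2_norm f"
  by (simp add: L2_norm_def norm_modulation)

text \<open>A modulation is a linear isometry mapping the span of an invariant \<open>S\<close> into
  itself, so it carries approximants of \<open>f\<close> to approximants of its image.\<close>

lemma modulation_closed_span:
  assumes S: "S \<subseteq> L2" and inv: "\<And>f. f \<in> S \<Longrightarrow> modulation c f \<in> S"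
    and f: "f \<in> closed_span S"
  shows "modulation c f \<in> closed_span S"
  unfolding closed_span_def
proof (intro CollectI conjI allI impI)
  show "modulation c f \<in> L2"
    using f closed_span_subset_L2 L2_modulation by auto
  fix e :: real assume "e > 0"
  then obtain h where h: "h \<in> cfun.span S" "L2_norm (f - h) < e"
    using f unfolding closed_span_def by blast
  have "modulation c h \<in> cfun.span S"
    using h(1)
  proof (induction rule: cfun.span_induct_alt)
    case base
    have "modulation c 0 = 0"
      by (simp add: modulation_def fun_eq_iff)
    then show ?case
      by (metis cfun.span_zero)
  next
    case (step d x y)
    show ?case
      unfolding modulation_add modulation_scale
      by (intro cfun.span_add cfun.span_scale cfun.span_base inv step)
  qed
  with h show "\<exists>h\<in>cfun.span S. L2_norm (modulation c f - h) < e"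
    by (metis L2_norm_modulation modulation_diff)
qed

section \<open>Multiplication by periodic functions\<close>

text \<open>The covering of the unit circle by the line, with period \<open>a\<close>; modulation by
  \<open>1 / a\<close> is multiplication by it.\<close>

definition zeta :: "real \<Rightarrow> real \<Rightarrow> complex" where
  "zeta a x = cis (2 * pi * x / a)"

lemma norm_zeta [simp]: "cmod (zeta a x) = 1"
  by (simp add: zeta_def)

lemma zeta_measurable [measurable]: "zeta a \<in> borel_measurable borel"
proof -
  have [measurable]: "cis \<in> borel_measurable borel"
    by (intro borel_measurable_continuous_onI continuous_intros)
  show ?thesis
    unfolding zeta_def by measurable
qed

lemma modulation_zeta: "modulation (1 / a) f = (\<lambda>x. zeta a x * f x)"
  by (simp add: modulation_cis zeta_def)

lemma modulation_cnj_zeta: "modulation (- 1 / a) f = (\<lambda>x. cnj (zeta a x) * f x)"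
  by (simp add: modulation_cis zeta_def cis_cnj)

lemma borel_measurable_Arg: "Arg \<in> borel_measurable borel"
proof -
  have 1: "(\<lambda>z. indicator (- \<real>\<^sub>\<le>\<^sub>0) z *\<^sub>R Arg z) \<in> borel_measurable borel"
    by (rule borel_measurable_continuous_on_indicator)
      (auto intro: continuous_on_Arg borel_closed closed_nonpos_Reals_complex)
  \<comment> \<open>On the cut \<open>Arg\<close> is pi, except at 0 where it is 0; the second
    indicator supplies these values.\<close>
  have "Arg z = indicator (- \<real>\<^sub>\<le>\<^sub>0) z *\<^sub>R Arg z + indicator (\<real>\<^sub>\<le>\<^sub>0 - {0}) z * pi" for z
  proof (cases "z \<in> \<real>\<^sub>\<le>\<^sub>0")
    case True
    then obtain r where r: "z = of_real r" "r \<le> 0"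
      by (auto simp: nonpos_Reals_def)
    then show ?thesis
      using True by (cases "r = 0") (auto simp: indicator_def Arg_zero)
  qed auto
  then have "Arg = (\<lambda>z. indicator (- \<real>\<^sub>\<le>\<^sub>0) z *\<^sub>R Arg z + indicator (\<real>\<^sub>\<le>\<^sub>0 - {0}) z * pi)"
    by blast
  moreover have "\<dots> \<in> borel_measurable borel"
    by (intro borel_measurable_add 1 borel_measurable_times borel_measurable_indicator
        sets.Diff borel_closed closed_nonpos_Reals_complex) auto
  ultimately show ?thesis by simp
qed

text \<open>\<open>a * Arg (zeta a x) / (2 * pi)\<close> is the representative of \<open>x\<close>
  modulo \<open>a\<close> in (-a/2, a/2], so \<open>c\<close> descends to the circle.\<close>

lemma periodic_factor:
  assumes a: "a > 0" and c: "periodic a c"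
  shows "c x = c (a * Arg (zeta a x) / (2 * pi))"
proof -
  have "cis (Arg (zeta a x)) = zeta a x"
    by (subst cis_Arg) (auto simp: zeta_def sgn_eq)
  then have "sin (Arg (zeta a x)) = sin (2 * pi * x / a) \<and> cos (Arg (zeta a x)) = cos
      (2 * pi * x / a)"
    by (metis zeta_def cis.sel)
  then obtain n where "Arg (zeta a x) = 2 * pi * x / a + 2 * pi * of_int n"
    by (auto simp: sin_cos_eq_iff)
  then have "a * Arg (zeta a x) / (2 * pi) = x - of_int (- n) * a"
    using a by (simp add: field_simps)
  then show ?thesis
    using periodicD[OF c] by metis
qed

section \<open>Multipliers of a modulation-invariant closed span\<close>

context
  fixes a :: real and S :: "(real \<Rightarrow> complex) set"
  assumes a: "a > 0" and S: "S \<subseteq> L2"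
    and inv: "\<And>m f. f \<in> S \<Longrightarrow> modulation (of_int m / a) f \<in> S"
begin

text \<open>\<open>C\<close> lives on the plane, so that polynomials, closed sets and Borel sets of
  the plane can be used, but only its values on the unit circle enter.\<close>

definition multiplier :: "(complex \<Rightarrow> complex) \<Rightarrow> bool" where
  "multiplier C \<longleftrightarrow> (\<forall>f\<in>closed_span S. (\<lambda>x. C (zeta a x) * f x) \<in> closed_span S)"

lemma multiplier_mult:
  assumes "multiplier C" "multiplier D"
  shows "multiplier (\<lambda>z. C z * D z)"
  using assms by (simp add: multiplier_def mult.assoc)

lemma multiplier_const: "multiplier (\<lambda>z. c)"
  using cfun.subspace_scale[OF subspace_closed_span[OF S]]
  by (auto simp: multiplier_def cscale_def)

lemma multiplier_add:
  assumes "multiplier C" "multiplier D"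
  shows "multiplier (\<lambda>z. C z + D z)"
  unfolding multiplier_def
proof
  fix f assume f: "f \<in> closed_span S"
  have "(\<lambda>x. C (zeta a x) * f x) + (\<lambda>x. D (zeta a x) * f x) \<in> closed_span S"
    using assms f by (intro cfun.subspace_add[OF subspace_closed_span[OF S]])
        (auto simp: multiplier_def)
  then show "(\<lambda>x. (C (zeta a x) + D (zeta a x)) * f x) \<in> closed_span S"
    by (simp add: plus_fun_def distrib_right)
qed

lemma multiplier_sum:
  "(\<And>k. k \<in> K \<Longrightarrow> multiplier (C k)) \<Longrightarrow> multiplier (\<lambda>z. \<Sum>k\<in>K. C k z)"
  by (induction K rule: infinite_finite_induct) (auto intro: multiplier_const multiplier_add)

lemma multiplier_id: "multiplier (\<lambda>z. z)"
  unfolding multiplier_def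
  using modulation_closed_span[OF S inv[of _ 1]] by (simp add: modulation_zeta)

lemma multiplier_cnj: "multiplier cnj"
  unfolding multiplier_def
  using modulation_closed_span[OF S inv[of _ "-1"]] by (simp add: modulation_cnj_zeta[symmetric])

lemma multiplier_polynomial:
  "real_polynomial_function p \<Longrightarrow> multiplier (\<lambda>z. of_real (p z))"
proof (induction rule: real_polynomial_function.induct)
  case (linear l)
  \<comment> \<open>Every real-linear functional on the complex numbers is a complex combination of
    z and its conjugate.\<close>
  have eq: "(\<lambda>z. complex_of_real (l z)) =
      (\<lambda>z. z * ((l 1 - \<i> * l \<i>) / 2) + cnj z * ((l 1 + \<i> * l \<i>) / 2))"
  proof
    fix z
    have "l z = l (Re z *\<^sub>R 1 + Im z *\<^sub>R \<i>)"
      by (intro arg_cong[where f = l]) (simp add: complex_eq_iff)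
    also have "\<dots> = Re z * l 1 + Im z * l \<i>"
      using bounded_linear.linear[OF linear] by (simp add: linear_add linear_scale)
    finally show "of_real (l z) = z * ((l 1 - \<i> * l \<i>) / 2) + cnj z * ((l 1 + \<i> * l \<i>) / 2)"
      by (simp add: complex_eq_iff field_simps)
  qed
  show ?case
    by (subst eq) (intro multiplier_add multiplier_mult multiplier_const multiplier_id
        multiplier_cnj)
next
  case (const c)
  show ?case by (rule multiplier_const)
next
  case (add f g)
  then show ?case using multiplier_add by simp
next
  case (mult f g)
  then show ?case using multiplier_mult by simp
qed

text \<open>The majorant \<open>B\<close> may be unbounded as long as \<open>B\<close> times
  \<open>f\<close> is square integrable; hence the conclusion concerns the one given
  \<open>f\<close>. The final passage to unbounded \<open>c\<close> uses this form.\<close>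

lemma multiplier_limit_L2:
  assumes C: "\<And>i. multiplier (C i)" and [measurable]: "D \<in> borel_measurable borel"
    and lim: "\<And>z. cmod z = 1 \<Longrightarrow> (\<lambda>i. C i z) \<longlonglongrightarrow> D z"
    and bound: "\<And>i z. cmod z = 1 \<Longrightarrow> cmod (C i z) \<le> B z"
    and f: "f \<in> closed_span S" and Bf: "integrable lborel (\<lambda>x. (B (zeta a x) * cmod (f x))\<^sup>2)"
  shows "(\<lambda>x. D (zeta a x) * f x) \<in> closed_span S"
proof -
  have [measurable]: "f \<in> borel_measurable borel"
    using f closed_span_subset_L2 L2_measurable by blast
  have B: "0 \<le> B z" if "cmod z = 1" for z
    using bound[OF that, of 0] norm_ge_zero order_trans by blast
  have D: "cmod (D z) \<le> B z" if "cmod z = 1" for z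
    using lim[OF that] bound[OF that] by (intro LIMSEQ_le_const2[OF tendsto_norm]) auto
  show ?thesis
  proof (rule closed_span_limit[OF S])
    show "(\<lambda>x. C i (zeta a x) * f x) \<in> closed_span S" for i
      using C f by (simp add: multiplier_def)
    have "integrable lborel (\<lambda>x. (cmod (D (zeta a x) * f x))\<^sup>2)"
      by (rule Bochner_Integration.integrable_bound[OF Bf])
        (auto simp: norm_mult B D intro!: power_mono mult_right_mono)
    then show "(\<lambda>x. D (zeta a x) * f x) \<in> L2"
      by (simp add: L2_def)
    show "(\<lambda>i. C i (zeta a x) * f x) \<longlonglongrightarrow> D (zeta a x) * f x" for x
      by (intro tendsto_intros lim) simp
    \<comment> \<open>Both \<open>C i\<close> and \<open>D\<close> are bounded by \<open>B\<close>,
      so their difference is at most 2 B; squaring gives the 4.\<close>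
    show "integrable lborel (\<lambda>x. 4 * (B (zeta a x) * cmod (f x))\<^sup>2)"
      using Bf by simp
    show "(cmod (C i (zeta a x) * f x - D (zeta a x) * f x))\<^sup>2 \<le> 4 * (B (zeta a x) * cmod (f x))\<^sup>2"
        for i x
    proof -
      have "cmod (C i (zeta a x) * f x - D (zeta a x) * f x) = cmod (C i (zeta a x) - D
          (zeta a x)) * cmod (f x)"
        by (metis left_diff_distrib norm_mult)
      also have "\<dots> \<le> (B (zeta a x) + B (zeta a x)) * cmod (f x)"
        by (intro mult_right_mono order_trans[OF norm_triangle_ineq4] add_mono bound D) auto
      finally have "cmod (C i (zeta a x) * f x - D (zeta a x) * f x) \<le> 2 * (B (zeta a x) * cmod
          (f x))"
        by simp
      then have "(cmod (C i (zeta a x) * f x - D (zeta a x) * f x))\<^sup>2 \<le> (2 * (B (zeta a x) * cmod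
          (f x)))\<^sup>2"
        by (rule power_mono) simp
      then show ?thesis
        by (simp add: power_mult_distrib)
    qed
  qed
qed

lemma multiplier_limit:
  assumes "\<And>i. multiplier (C i)" "D \<in> borel_measurable borel"
    and "\<And>z. cmod z = 1 \<Longrightarrow> (\<lambda>i. C i z) \<longlonglongrightarrow> D z"
    and "\<And>i z. cmod z = 1 \<Longrightarrow> cmod (C i z) \<le> B"
  shows "multiplier D"
  unfolding multiplier_def
proof
  fix f assume f: "f \<in> closed_span S"
  then have "f \<in> L2"
    using closed_span_subset_L2 by blast
  then have "integrable lborel (\<lambda>x. (B * cmod (f x))\<^sup>2)"
    by (simp add: L2_def power_mult_distrib)
  then show "(\<lambda>x. D (zeta a x) * f x) \<in> closed_span S"
    by (intro multiplier_limit_L2[where C = C and B = "\<lambda>z. B"] assms f)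
qed

text \<open>Stone--Weierstrass is applied on the unit circle only: there \<open>p i\<close> is
  within 1/(i + 1) of \<open>\<phi>\<close>, which yields convergence and the uniform bound
  \<open>B + 1\<close>.\<close>

lemma multiplier_continuous:
  assumes phi: "continuous_on UNIV \<phi>" and bound: "\<And>z. \<bar>\<phi> z\<bar> \<le> B"
  shows "multiplier (\<lambda>z. of_real (\<phi> z))"
proof -
  have "\<exists>p. real_polynomial_function p \<and> (\<forall>z\<in>sphere 0 1. \<bar>\<phi> z - p z\<bar> < inverse (real (Suc i)))"
      for i
  proof -
    have "0 < inverse (real (Suc i))"
      by simp
    from Stone_Weierstrass_real_polynomial_function[OF compact_sphere
        continuous_on_subset[OF phi subset_UNIV] this, of 0 1]
    obtain p where "real_polynomial_function p"
      "\<And>z. z \<in> sphere 0 1 \<Longrightarrow> \<bar>\<phi> z - p z\<bar> < inverse (real (Suc i))"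
      by blast
    then show ?thesis by blast
  qed
  then obtain p where p: "\<And>i. real_polynomial_function (p i)"
    and close: "\<And>i z. cmod z = 1 \<Longrightarrow> \<bar>\<phi> z - p i z\<bar> < inverse (real (Suc i))"
    by (metis mem_sphere_0)
  show ?thesis
  proof (rule multiplier_limit)
    show "multiplier (\<lambda>z. of_real (p i z))" for i
      by (intro multiplier_polynomial p)
    show "(\<lambda>z. complex_of_real (\<phi> z)) \<in> borel_measurable borel"
      by (intro borel_measurable_continuous_onI continuous_intros phi)
    fix z :: complex assume z: "cmod z = 1"
    have "(\<lambda>i. p i z - \<phi> z) \<longlonglongrightarrow> 0"
      by (rule tendsto_rabs_zero_cancel, rule tendsto_sandwich[OF _ _ tendsto_const
          LIMSEQ_inverse_real_of_nat])
        (use close[OF z] in \<open>auto intro!: always_eventually less_imp_le simp: abs_minus_commute simp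
            del: of_nat_Suc\<close>)
    then have "(\<lambda>i. p i z) \<longlonglongrightarrow> \<phi> z"
      by (simp add: LIM_zero_iff)
    then show "(\<lambda>i. complex_of_real (p i z)) \<longlonglongrightarrow> of_real (\<phi> z)"
      by (rule tendsto_of_real)
    show "cmod (of_real (p i z)) \<le> B + 1" for i
    proof -
      have "inverse (real (Suc i)) \<le> 1"
        by (simp add: field_simps)
      then show ?thesis
        using close[OF z, of i] bound[of z] by simp
    qed
  qed
qed

lemma multiplier_closed:
  assumes F: "closed F"
  shows "multiplier (indicator F)"
\<comment> \<open>The empty set is separate because \<open>infdist\<close> to it is 0 by convention,
  so the cut-offs below would be 1 everywhere.\<close>
proof (cases "F = {}")
  case True
  then show ?thesis
    using multiplier_const[of 0] by (simp add: indicator_def[abs_def])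
next
  case False
  show ?thesis
  proof (rule multiplier_limit)
    \<comment> \<open>Continuous cut-offs, equal to 1 on \<open>F\<close> and, for i > 0, to 0 at
      distance at least 1/i from it; for closed \<open>F\<close> they converge to the
      indicator.\<close>
    define \<phi> where "\<phi> i z = max 0 (1 - real i * infdist z F)" for i z
    show "multiplier (\<lambda>z. of_real (\<phi> i z))" for i
    proof (rule multiplier_continuous)
      show "continuous_on UNIV (\<phi> i)"
        unfolding \<phi>_def by (intro continuous_intros)
      show "\<bar>\<phi> i z\<bar> \<le> 1" for z
        by (simp add: \<phi>_def infdist_nonneg)
    qed
    show "(indicator F :: complex \<Rightarrow> complex) \<in> borel_measurable borel"
      using F by (simp add: borel_closed)
    fix z :: complex
    show "cmod (of_real (\<phi> i z)) \<le> 1" for i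
      by (simp add: \<phi>_def infdist_nonneg)
    show "(\<lambda>i. complex_of_real (\<phi> i z)) \<longlonglongrightarrow> indicator F z"
    proof (cases "z \<in> F")
      case True
      then have "\<phi> i z = 1" for i
        by (simp add: \<phi>_def)
      with True show ?thesis by simp
    next
      case notin: False
      then have pos: "infdist z F > 0"
        using F False by (simp add: infdist_pos_not_in_closed)
      obtain N where N: "real N > 1 / infdist z F"
        using reals_Archimedean2 by blast
      have "\<phi> i z = 0" if "i \<ge> N" for i
      proof -
        have "1 \<le> real N * infdist z F"
          using N pos by (simp add: field_simps)
        also have "\<dots> \<le> real i * infdist z F"
          using that pos by (intro mult_right_mono) auto
        finally show ?thesis by (simp add: \<phi>_def)
      qed
      then have "\<forall>\<^sub>F i in sequentially. complex_of_real (\<phi> i z) = 0"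
        by (auto simp: eventually_sequentially)
      then show ?thesis
        using notin by (simp add: tendsto_eventually)
    qed
  qed
qed

text \<open>Closed sets form an intersection-stable generator of the Borel sets, and the sets whose
  indicators are multipliers are stable under complements and countable disjoint unions.\<close>

lemma multiplier_indicator:
  assumes "A \<in> sets borel"
  shows "multiplier (indicator A)"
proof -
  have "Int_stable (Collect closed :: complex set set)"
    by (auto simp: Int_stable_def)
  moreover have "(Collect closed :: complex set set) \<subseteq> Pow UNIV"
    by auto
  moreover have "A \<in> sigma_sets UNIV (Collect closed)"
    using assms by (simp add: borel_eq_closed)
  ultimately show ?thesis
  proof (induction rule: sigma_sets_induct_disjoint)
    case (basic A)
    then show ?case by (simp add: multiplier_closed)
  next
    case empty
    show ?case
      using multiplier_const[of 0] by (simp add: indicator_def[abs_def])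
  next
    case (compl A)
    have "multiplier (\<lambda>z. 1 + (- 1) * indicator A z)"
      by (intro multiplier_add multiplier_mult multiplier_const compl)
    moreover have "(\<lambda>z. 1 + (- 1) * indicator A z) = (indicator (UNIV - A) :: complex \<Rightarrow> complex)"
      by (auto simp: indicator_def fun_eq_iff)
    ultimately show ?case by simp
  next
    case (union A)
    have A: "A i \<in> sets borel" for i
      using union(2) by (auto simp: borel_eq_closed)
    show ?case
    proof (rule multiplier_limit)
      \<comment> \<open>Disjointness turns the indicator of a finite union into a sum of
        multipliers; the countable union is then a pointwise limit bounded by 1.\<close>
      have "multiplier (\<lambda>z. \<Sum>i<n. indicator (A i) z)" for n
        by (intro multiplier_sum union)
      moreover have "(\<lambda>z. \<Sum>i<n. indicator (A i) z) = (indicator (\<Union>i<n. A i) :: complex \<Rightarrow> complex)"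
          for n
        by (rule ext, rule indicator_UN_disjoint[symmetric])
          (use union(1) in \<open>auto simp: disjoint_family_on_def\<close>)
      ultimately show "multiplier (indicator (\<Union>i<n. A i))" for n
        by simp
      show "(indicator (\<Union> (range A)) :: complex \<Rightarrow> complex) \<in> borel_measurable borel"
        using A by auto
      show "(\<lambda>n. indicator (\<Union>i<n. A i) z :: complex) \<longlonglongrightarrow> indicator (\<Union> (range A)) z" for z
        by (rule LIMSEQ_indicator_UN)
      show "cmod (indicator (\<Union>i<n. A i) z) \<le> 1" for n z
        by (simp add: indicator_def)
    qed
  qed
qed

lemma multiplier_simple:
  assumes "simple_function borel F"
  shows "multiplier F"
proof -
  have fin: "finite (range F)" and F: "F -` {y} \<in> sets borel" for y
    using assms simple_functionD[OF assms] by (auto simp: vimage_def)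
  have eq: "F = (\<lambda>z. \<Sum>y\<in>range F. y * indicator (F -` {y}) z)"
  proof
    fix z
    have "(\<Sum>y\<in>range F. y * indicator (F -` {y}) z) = (\<Sum>y\<in>{F z}. y * indicator (F -` {y}) z)"
      using fin by (intro sum.mono_neutral_right) (auto simp: indicator_def)
    then show "F z = (\<Sum>y\<in>range F. y * indicator (F -` {y}) z)"
      by simp
  qed
  show ?thesis
    by (subst eq) (intro multiplier_sum multiplier_mult multiplier_const multiplier_indicator F)
qed

text \<open>The circle function \<open>C\<close> may be unbounded. Simple functions approximate it
  with |F i| \<le> 2|C|, and the majorant 2|C| times |f| is 2|c f|, square integrable by
  \<open>cf\<close>.\<close>

lemma closed_span_periodic_mult:
  assumes f: "f \<in> closed_span S" and c: "periodic a c" and [measurable]: "c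
      \<in> borel_measurable borel"
    and cf: "(\<lambda>x. c x * f x) \<in> L2"
  shows "(\<lambda>x. c x * f x) \<in> closed_span S"
proof -
  define C where "C z = c (a * Arg z / (2 * pi))" for z
  note [measurable] = borel_measurable_Arg
  have C [measurable]: "C \<in> borel_measurable borel"
    unfolding C_def by measurable
  have cC: "c x = C (zeta a x)" for x
    unfolding C_def by (rule periodic_factor[OF a c])
  obtain F where F: "\<And>i. simple_function borel (F i)" "\<And>z. (\<lambda>i. F i z) \<longlonglongrightarrow> C z"
      "\<And>i z. cmod (F i z) \<le> 2 * cmod (C z)"
    using borel_measurable_implies_sequence_metric[OF C, of 0] by (auto simp: dist_norm)
  have "integrable lborel (\<lambda>x. (2 * cmod (C (zeta a x)) * cmod (f x))\<^sup>2)"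
  proof -
    have "(\<lambda>x. (2 * cmod (C (zeta a x)) * cmod (f x))\<^sup>2) = (\<lambda>x. 4 * (cmod (c x * f x))\<^sup>2)"
      by (simp add: cC norm_mult power_mult_distrib mult.assoc)
    then show ?thesis
      using cf by (simp add: L2_def)
  qed
  from multiplier_limit_L2[OF multiplier_simple[OF F(1)] C F(2,3) f this]
  show ?thesis by (simp add: cC)
qed

end

section \<open>The span of the integer modulations\<close>

lemma a_span_generators_L2:
  assumes "\<And>i. i \<in> I \<Longrightarrow> g i \<in> L2"
  shows "{modulation (of_int m / a) (g i) | m i. i \<in> I} \<subseteq> L2"
  using assms by (auto intro: L2_modulation)

text \<open>Modulations compose by adding frequencies, so the generators have the invariance on
  which multiplication by periodic functions rests.\<close>

lemma a_span_generators_modulation: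
  assumes "f \<in> {modulation (of_int m / a) (g i) | m i. i \<in> I}"
  shows "modulation (of_int k / a) f \<in> {modulation (of_int m / a) (g i) | m i. i \<in> I}"
proof -
  from assms obtain m i where "f = modulation (of_int m / a) (g i)" "i \<in> I" by blast
  then have "modulation (of_int k / a) f = modulation (of_int (k + m) / a) (g i)" "i \<in> I"
    by (simp_all add: modulation_modulation add_divide_distrib)
  then show ?thesis by blast
qed

lemma a_span_base:
  assumes "\<And>i. i \<in> I \<Longrightarrow> g i \<in> L2" "i \<in> I"
  shows "g i \<in> a_span a g I"
proof -
  have "g i = modulation (of_int 0 / a) (g i)"
    by (simp add: modulation_0)
  then have "g i \<in> {modulation (of_int m / a) (g i) | m i. i \<in> I}"
    using assms(2) by blast
  then show ?thesis
    unfolding a_span_def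
    by (rule subsetD[OF span_subset_closed_span[OF a_span_generators_L2[OF assms(1)]]
          cfun.span_base, rotated])
qed

lemma a_span_subspace:
  assumes "\<And>i. i \<in> I \<Longrightarrow> g i \<in> L2"
  shows "cfun.subspace (a_span a g I)"
  unfolding a_span_def by (intro subspace_closed_span a_span_generators_L2 assms)

text \<open>Both inclusions between spans rest on this: checking the unmodulated \<open>e j\<close>
  suffices, since the larger span is modulation invariant.\<close>

lemma a_span_minimal:
  assumes g: "\<And>i. i \<in> I \<Longrightarrow> g i \<in> L2" and e: "\<And>j. j \<in> J \<Longrightarrow> e j \<in> a_span a g I"
  shows "a_span a e J \<subseteq> a_span a g I"
  unfolding a_span_def
proof (rule closed_span_minimal)
  let ?S = "{modulation (of_int m / a) (g i) | m i. i \<in> I}"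
  show S: "?S \<subseteq> L2"
    by (rule a_span_generators_L2[OF g])
  show "{modulation (of_int m / a) (e j) | m j. j \<in> J} \<subseteq> closed_span ?S"
    using modulation_closed_span[OF S a_span_generators_modulation] e
    by (auto simp: a_span_def)
qed

lemma a_span_mono:
  assumes "\<And>i. i \<in> I \<Longrightarrow> g i \<in> L2" "J \<subseteq> I"
  shows "a_span a g J \<subseteq> a_span a g I"
  using assms by (intro a_span_minimal a_span_base) auto

lemma a_span_periodic_mult:
  assumes "a > 0" "\<And>i. i \<in> I \<Longrightarrow> g i \<in> L2" "f \<in> a_span a g I"
    and "periodic a c" "c \<in> borel_measurable borel" "(\<lambda>x. c x * f x) \<in> L2"
  shows "(\<lambda>x. c x * f x) \<in> a_span a g I"
  unfolding a_span_def
  by (rule closed_span_periodic_mult[OF assms(1) a_span_generators_L2[OF assms(2)]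
        a_span_generators_modulation assms(3)[unfolded a_span_def] assms(4-6)])

lemma a_span_cong_AE:
  assumes "\<And>i. i \<in> I \<Longrightarrow> g i \<in> L2" "f \<in> a_span a g I" "h \<in> borel_measurable borel"
    "AE x in lborel. f x = h x"
  shows "h \<in> a_span a g I"
  using assms unfolding a_span_def
  by (intro closed_span_cong_AE[where f = f and g = h] a_span_generators_L2)

lemma sum_fun_eq: "(\<Sum>k\<in>K. (f k :: real \<Rightarrow> complex)) = (\<lambda>x. \<Sum>k\<in>K. f k x)"
  by (induction K rule: infinite_finite_induct) (auto simp: fun_eq_iff)

lemma a_span_sum:
  assumes "\<And>i. i \<in> I \<Longrightarrow> g i \<in> L2" "\<And>k. k \<in> K \<Longrightarrow> f k \<in> a_span a g I"
  shows "(\<lambda>x. \<Sum>k\<in>K. f k x) \<in> a_span a g I"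
  using cfun.subspace_sum[OF a_span_subspace, of I g K f a] assms by (simp add: sum_fun_eq)

section \<open>Fibrewise Gram--Schmidt\<close>

text \<open>Coefficients and norm are functions of \<open>x\<close>, so one recursion
  orthonormalises all fibres at once; \<open>inverse 0 = 0\<close> handles the fibres where the
  residual has norm 0.\<close>

function gram_schmidt :: "real \<Rightarrow> (nat \<Rightarrow> real \<Rightarrow> complex) \<Rightarrow> nat \<Rightarrow> real \<Rightarrow> complex" where
  "gram_schmidt a g n =
     (let r = (\<lambda>x. g n x - (\<Sum>k<n. a_inner a (g n) (gram_schmidt a g k) x * gram_schmidt a g k x))
      in (\<lambda>x. inverse (of_real (a_norm a r x)) * r x))"
  by auto
termination
  by (relation "Wellfounded.measure (\<lambda>(a, g, n). n)") auto

declare gram_schmidt.simps [simp del]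

definition residual :: "real \<Rightarrow> (nat \<Rightarrow> real \<Rightarrow> complex) \<Rightarrow> nat \<Rightarrow> real \<Rightarrow> complex" where
  "residual a g n =
     (\<lambda>x. g n x - (\<Sum>k<n. a_inner a (g n) (gram_schmidt a g k) x * gram_schmidt a g k x))"

lemma gram_schmidt_eq:
  "gram_schmidt a g n = (\<lambda>x. inverse (of_real (a_norm a (residual a g n) x)) * residual a g n x)"
  by (subst gram_schmidt.simps) (simp add: residual_def Let_def)

lemma periodic_inverse_a_norm: "periodic a (\<lambda>x. inverse (complex_of_real (a_norm a f x)))"
  using periodic_a_norm[of a f] by (simp add: periodic_def)

lemma fiber_l2_gram_schmidt:
  assumes "\<And>k. fiber_l2 a (g k) t"
  shows "fiber_l2 a (residual a g n) t" and "fiber_l2 a (gram_schmidt a g n) t"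
proof -
  have res: "fiber_l2 a (residual a g n) t" if "\<And>k. k < n \<Longrightarrow> fiber_l2 a (gram_schmidt a g k) t" for n
    unfolding residual_def
    by (intro fiber_l2_diff fiber_l2_sum fiber_l2_scale assms that periodic_a_inner) auto
  have gs: "fiber_l2 a (gram_schmidt a g n) t" for n
  proof (induction n rule: less_induct)
    case (less n)
    then show ?case
      unfolding gram_schmidt_eq[of a g n]
      by (intro fiber_l2_scale res periodic_inverse_a_norm)
  qed
  show "fiber_l2 a (gram_schmidt a g n) t" "fiber_l2 a (residual a g n) t"
    using gs res by auto
qed

text \<open>Homogeneity gives \<open>inverse N * N\<close> with \<open>N\<close> the norm of the
  residual, which is 1, or 0 when \<open>N = 0\<close>; this holds at every
  \<open>t\<close>.\<close>

lemma a_norm_gram_schmidt: "a_norm a (gram_schmidt a g n) t \<in> {0, 1}"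
  unfolding gram_schmidt_eq
  by (subst a_norm_scale[OF periodic_inverse_a_norm])
    (cases "a_norm a (residual a g n) t = 0", auto simp: a_norm_nonneg norm_inverse)

lemma residual_eq:
  assumes "\<And>k. fiber_l2 a (g k) t"
  shows "residual a g n t = of_real (a_norm a (residual a g n) t) * gram_schmidt a g n t"
proof (cases "a_norm a (residual a g n) t = 0")
  case True
  \<comment> \<open>Norm 0 forces the whole fibre to vanish; index 0 picks out the point
    \<open>t\<close> itself.\<close>
  have "residual a g n (t - of_int 0 * a) = 0"
    using fiber_l2_gram_schmidt(1)[OF assms] True by (rule a_norm_eq_0D)
  then show ?thesis
    using True by simp
next
  case False
  then show ?thesis
    by (simp add: gram_schmidt_eq)
qed

text \<open>Pairing the residual with the \<open>m\<close>-th vector leaves, by induction, only the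
  term \<open>k = m\<close> of the sum, which cancels the coefficient of \<open>g n\<close>; the
  normalising factor is a scalar on the fibre.\<close>

lemma a_inner_gram_schmidt_less:
  assumes g: "\<And>k. fiber_l2 a (g k) t" and "m < n"
  shows "a_inner a (gram_schmidt a g n) (gram_schmidt a g m) t = 0"
  using \<open>m < n\<close>
proof (induction n arbitrary: m rule: less_induct)
  case (less n)
  let ?e = "gram_schmidt a g"
  note l2 = fiber_l2_gram_schmidt[of a g t, OF g]
  \<comment> \<open>The induction hypothesis has the larger index on the left; conjugate symmetry
    covers \<open>k < m\<close>.\<close>
  have orth: "a_inner a (?e k) (?e m) t = 0" if "k < n" "k \<noteq> m" for k
    using less.IH[of k m] less.IH[of m k] a_inner_cnj[of a "?e k" "?e m" t] that less.prems
    by (cases k m rule: linorder_cases) auto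
  have "a_inner a (residual a g n) (?e m) t =
      a_inner a (g n) (?e m) t - (\<Sum>k<n. a_inner a (g n) (?e k) t * a_inner a (?e k) (?e m) t)"
  proof -
    have proj: "fiber_l2 a (\<lambda>x. a_inner a (g n) (?e k) x * ?e k x) t" for k
      by (intro fiber_l2_scale l2 periodic_a_inner)
    show ?thesis
      unfolding residual_def
      by (subst a_inner_diff_left[OF g fiber_l2_sum l2(2)], rule proj,
          subst a_inner_sum_left[OF proj l2(2)])
        (simp add: a_inner_scale_left[OF periodic_a_inner])
  qed
  also have "(\<Sum>k<n. a_inner a (g n) (?e k) t * a_inner a (?e k) (?e m) t) =
      (\<Sum>k\<in>{m}. a_inner a (g n) (?e k) t * a_inner a (?e k) (?e m) t)"
    using less.prems orth by (intro sum.mono_neutral_right) auto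
  \<comment> \<open>Either \<open>?e m\<close> has norm 1 at \<open>t\<close> and the two terms
    cancel, or it vanishes on the fibre and the coefficient is itself 0.\<close>
  also have "a_inner a (g n) (?e m) t - \<dots> = 0"
    using a_norm_gram_schmidt[of a g m t] a_inner_eq_0_of_a_norm_eq_0[OF l2(2), of m "g n"]
    by (auto simp: a_norm_squared[of a "?e m"])
  finally show ?case
    unfolding gram_schmidt_eq[of a g n] by (simp add: a_inner_scale_left[OF
        periodic_inverse_a_norm])
qed

lemma a_inner_gram_schmidt_neq:
  assumes "\<And>k. fiber_l2 a (g k) t" "m \<noteq> n"
  shows "a_inner a (gram_schmidt a g n) (gram_schmidt a g m) t = 0"
proof (cases "m < n")
  case True
  then show ?thesis using a_inner_gram_schmidt_less assms by blast
next
  case False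
  then have "a_inner a (gram_schmidt a g m) (gram_schmidt a g n) t = 0"
    using a_inner_gram_schmidt_less assms by (metis nat_neq_iff)
  then show ?thesis by (metis a_inner_cnj complex_cnj_zero)
qed

section \<open>Measurability, square integrability and spans of the Gram--Schmidt sequence\<close>

context
  fixes a :: real and g :: "nat \<Rightarrow> real \<Rightarrow> complex"
  assumes a: "a > 0" and g: "\<And>n. g n \<in> L2"
begin

lemma AE_fiber_l2_all: "AE t in lborel. \<forall>k. fiber_l2 a (g k) t"
  using L2_AE_fiber_l2[OF a g] by (simp add: AE_all_countable)

lemma gram_schmidt_measurable:
  "residual a g n \<in> borel_measurable borel" "gram_schmidt a g n \<in> borel_measurable borel"
proof -
  note [measurable] = L2_measurable[OF g]
  have res: "residual a g n \<in> borel_measurable borel"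
    if [measurable]: "\<And>k. k < n \<Longrightarrow> gram_schmidt a g k \<in> borel_measurable borel" for n
    unfolding residual_def
    by (intro borel_measurable_diff borel_measurable_sum borel_measurable_times) auto
  have gs: "gram_schmidt a g n \<in> borel_measurable borel" for n
  proof (induction n rule: less_induct)
    case (less n)
    note [measurable] = res[OF less]
    show ?case
      unfolding gram_schmidt_eq[of a g n] by measurable
  qed
  show "gram_schmidt a g n \<in> borel_measurable borel" "residual a g n \<in> borel_measurable borel"
    using gs res by auto
qed

text \<open>Fibre norm at most 1 over a period of length \<open>a\<close> bounds the squared L2 norm
  by \<open>a\<close>.\<close>

lemma gram_schmidt_L2: "gram_schmidt a g n \<in> L2"
proof (rule L2_of_a_norm_le[OF a gram_schmidt_measurable(2), where B = "\<lambda>t. 1"])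
  show "AE t in lborel. fiber_l2 a (gram_schmidt a g n) t"
    using AE_fiber_l2_all by eventually_elim (simp add: fiber_l2_gram_schmidt)
  show "AE t in lborel. ennreal ((a_norm a (gram_schmidt a g n) t)\<^sup>2) \<le> 1"
  proof (intro always_eventually allI)
    show "ennreal ((a_norm a (gram_schmidt a g n) t)\<^sup>2) \<le> 1" for t
      using a_norm_gram_schmidt[of a g n t] by auto
  qed
  show "(\<integral>\<^sup>+t. 1 * indicator {0..<a} t \<partial>lborel) < \<infinity>"
    using a by simp
qed

text \<open>The coefficient may be unbounded; Bessel on each fibre dominates the fibre norm of the
  projection by that of \<open>g n\<close>, whose square is integrable over a period.\<close>

lemma projection_L2: "(\<lambda>x. a_inner a (g n) (gram_schmidt a g k) x * gram_schmidt a g k x) \<in> L2"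
proof (rule L2_of_a_norm_le[OF a _ _ _ L2_a_norm_integral[OF a g[of n]]])
  note [measurable] = L2_measurable[OF g] gram_schmidt_measurable
  show "(\<lambda>x. a_inner a (g n) (gram_schmidt a g k) x * gram_schmidt a g k x)
      \<in> borel_measurable borel"
    by measurable
  show "AE t in lborel. fiber_l2 a (\<lambda>x. a_inner a (g n)
      (gram_schmidt a g k) x * gram_schmidt a g k x) t"
    using AE_fiber_l2_all
    by eventually_elim (simp add: fiber_l2_gram_schmidt fiber_l2_scale periodic_a_inner)
  show "AE t in lborel. ennreal ((a_norm a (\<lambda>x. a_inner a (g n)
      (gram_schmidt a g k) x * gram_schmidt a g k x) t)\<^sup>2)
      \<le> ennreal ((a_norm a (g n) t)\<^sup>2)"
    using AE_fiber_l2_all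
  proof eventually_elim
    case (elim t)
    then have "cmod (a_inner a (g n) (gram_schmidt a g k) t) \<le> a_norm a (g n) t"
      by (intro bessel_single a_norm_gram_schmidt) (auto simp: fiber_l2_gram_schmidt)
    then have "a_norm a (\<lambda>x. a_inner a (g n) (gram_schmidt a g k) x * gram_schmidt a g k x) t
        \<le> a_norm a (g n) t"
      using a_norm_gram_schmidt[of a g k t]
      by (auto simp: a_norm_scale[OF periodic_a_inner] a_norm_nonneg)
    then show ?case
      by (intro ennreal_leI power_mono) (auto simp: a_norm_nonneg)
  qed
qed

lemma projection_a_span:
  assumes "\<And>i. i \<in> I \<Longrightarrow> h i \<in> L2" "gram_schmidt a g k \<in> a_span a h I"
  shows "(\<lambda>x. a_inner a (g n) (gram_schmidt a g k) x * gram_schmidt a g k x) \<in> a_span a h I"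
  by (intro a_span_periodic_mult a assms periodic_a_inner projection_L2
      borel_measurable_a_inner gram_schmidt_measurable L2_measurable g)

lemma a_orthonormal_gram_schmidt: "a_orthonormal a (gram_schmidt a g)"
  unfolding a_orthonormal_def
proof (intro conjI allI impI)
  show "gram_schmidt a g n \<in> L2" for n
    by (rule gram_schmidt_L2)
  show "AE t in lborel. a_inner a (gram_schmidt a g n) (gram_schmidt a g m) t = 0" if "n \<noteq> m"
      for n m
    using AE_fiber_l2_all by eventually_elim (use that in \<open>auto intro: a_inner_gram_schmidt_neq\<close>)
  show "AE t in lborel. a_norm a (gram_schmidt a g n) t \<noteq> 0 \<longrightarrow> a_norm a (gram_schmidt a g n) t = 1"
      for n
    using a_norm_gram_schmidt[of a g n] by (intro always_eventually) blast
qed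

lemma residual_sum: "residual a g n = g n - (\<lambda>x. \<Sum>k<n. a_inner a (g n)
    (gram_schmidt a g k) x * gram_schmidt a g k x)"
  by (simp add: residual_def fun_eq_iff)

lemma residual_L2: "residual a g n \<in> L2"
proof -
  have "(\<Sum>k<n. (\<lambda>x. a_inner a (g n) (gram_schmidt a g k) x * gram_schmidt a g k x)) \<in> L2"
    by (intro cfun.subspace_sum subspace_L2 projection_L2)
  then show ?thesis
    unfolding residual_sum by (intro L2_diff g) (simp add: sum_fun_eq)
qed

text \<open>Strong induction puts the projections, hence the residual, in the span. The normalising
  factor is periodic but possibly unbounded, so membership of the product in L2 has to be
  supplied.\<close>

lemma gram_schmidt_in_a_span: "gram_schmidt a g n \<in> a_span a g {..n}"
proof (induction n rule: less_induct)
  case (less n)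
  have "gram_schmidt a g k \<in> a_span a g {..n}" if "k < n" for k
    using less[OF that] a_span_mono[of "{..n}" g "{..k}" a] g that by auto
  then have "residual a g n \<in> a_span a g {..n}"
    unfolding residual_sum
    by (intro cfun.subspace_diff a_span_subspace a_span_base a_span_sum projection_a_span g) auto
  moreover have "(\<lambda>x. inverse (of_real (a_norm a (residual a g n) x)) * residual a g n x) \<in> L2"
    using gram_schmidt_L2[of n] by (simp add: gram_schmidt_eq)
  moreover note [measurable] = gram_schmidt_measurable(1)[of n]
  have "(\<lambda>x. inverse (complex_of_real (a_norm a (residual a g n) x))) \<in> borel_measurable borel"
    by measurable
  ultimately show ?case
    unfolding gram_schmidt_eq[of a g n]
    by (intro a_span_periodic_mult a g periodic_inverse_a_norm)
qed

text \<open>Normalisation is undone: the norm of the residual times the \<open>n\<close>-th vector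
  is a periodic multiple, so it stays in the span; it equals the residual almost everywhere, and
  adding the projections returns \<open>g n\<close>.\<close>

lemma in_a_span_gram_schmidt: "g n \<in> a_span a (gram_schmidt a g) {..n}"
proof -
  let ?e = "gram_schmidt a g"
  let ?V = "a_span a ?e {..n}"
  let ?s = "\<lambda>x. of_real (a_norm a (residual a g n) x) * ?e n x"
  note [measurable] = gram_schmidt_measurable
  have e: "?e k \<in> ?V" if "k \<le> n" for k
    using that by (intro a_span_base gram_schmidt_L2) auto
  have AE: "AE x in lborel. residual a g n x = ?s x"
    using AE_fiber_l2_all by eventually_elim (simp add: residual_eq)
  \<comment> \<open>Square integrability of \<open>?s\<close> is inherited from the residual through
    the almost everywhere identity.\<close>
  have "integrable lborel (\<lambda>x. (cmod (?s x))\<^sup>2) \<longleftrightarrow> integrable lborel (\<lambda>x. (cmod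
      (residual a g n x))\<^sup>2)"
    by (rule integrable_cong_AE) (use AE in auto)
  then have "?s \<in> L2"
    using residual_L2[of n] by (simp add: L2_def)
  then have "?s \<in> ?V"
    using periodic_a_norm[of a "residual a g n"]
    by (intro a_span_periodic_mult a gram_schmidt_L2 e) (auto simp: periodic_def)
  then have "residual a g n \<in> ?V"
    by (rule a_span_cong_AE[rotated]) (use AE gram_schmidt_L2 in auto)
  moreover have "(\<lambda>x. \<Sum>k<n. a_inner a (g n) (?e k) x * ?e k x) \<in> ?V"
    by (intro a_span_sum projection_a_span gram_schmidt_L2 e) auto
  ultimately have "residual a g n + (\<lambda>x. \<Sum>k<n. a_inner a (g n) (?e k) x * ?e k x) \<in> ?V"
    by (intro cfun.subspace_add a_span_subspace gram_schmidt_L2)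
  then show ?thesis
    by (simp add: residual_sum)
qed

lemma a_span_gram_schmidt: "a_span a g {..n} = a_span a (gram_schmidt a g) {..n}"
proof
  show "a_span a g {..n} \<subseteq> a_span a (gram_schmidt a g) {..n}"
  proof (rule a_span_minimal[OF gram_schmidt_L2])
    show "g k \<in> a_span a (gram_schmidt a g) {..n}" if "k \<in> {..n}" for k
    proof -
      have "a_span a (gram_schmidt a g) {..k} \<subseteq> a_span a (gram_schmidt a g) {..n}"
        using that by (intro a_span_mono gram_schmidt_L2) simp
      then show ?thesis
        using in_a_span_gram_schmidt[of k] by (rule subsetD)
    qed
  qed
  show "a_span a (gram_schmidt a g) {..n} \<subseteq> a_span a g {..n}"
  proof (rule a_span_minimal[OF g])
    show "gram_schmidt a g k \<in> a_span a g {..n}" if "k \<in> {..n}" for k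
    proof -
      have "a_span a g {..k} \<subseteq> a_span a g {..n}"
        using that by (intro a_span_mono g) simp
      then show ?thesis
        using gram_schmidt_in_a_span[of k] by (rule subsetD)
    qed
  qed
qed

end

text \<open>Indices start at 0, so \<open>{..n}\<close> selects the first \<open>n + 1\<close>
  terms.\<close>

theorem theorem9p3:
  fixes a :: real and g :: "nat \<Rightarrow> real \<Rightarrow> complex"
  assumes "a > 0"
    and "\<And>n. g n \<in> L2"
    and "a_independent a g UNIV"
  shows "\<exists>e. a_orthonormal a e \<and> (\<forall>n. a_span a g {..n} = a_span a e {..n})"
  by (intro exI[of _ "gram_schmidt a g"] conjI allI a_orthonormal_gram_schmidt
      a_span_gram_schmidt assms(1,2))

end
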